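(* Let $X:=l^p$ for some $1\le p<\infty$ or $X:=c_0$. For each $1\le j\le N$ let $(\omega_{j,n})_{n\in\mathbb N}$ be a sequence of positive reals and let the unilateral weighted backward shift $T_j$ be given by $$T_j\langle x_n\rangle_{n\in\mathbb N}:=\langle\omega_{j,n}x_{n+1}\rangle_{n\in\mathbb N},\qquad D(T_j):=\{\langle x_n\rangle_{n\in\mathbb N}\in X:\ T_j\langle x_n\rangle_{n\in\mathbb N}\in X\}.$$ Suppose, further, that there exists a bounded sequence $(a_n)_{n\in\mathbb N}$ of positive reals such that for each $k\in\mathbb N$ and $1\le j\le N$ we have $$B_{j,k}:=\sup_{n\in\mathbb N}\Bigl[a_{k+n}\prod_{i=n}^{k+n-1}\omega_{j,i}\Bigr]<\infty.$$ If either (i) $X=l^p$ with $p\ne2$ or $X=c_0$, and for each $1\le j\le N$ we have $\sum_{k=1}^\infty\frac1{B_{j,k}}<\infty$, or (ii) $X=l^2$ and for each $1\le j\le N$ we have $\sum_{k=1}^\infty\frac1{B_{j,k}^2}<\infty$, then the operators $T_1,\dots,T_N$ are densely $(d,1)$-distributionally chaotic.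
   Context: The sequence spaces $l^p=l^p(\mathbb N)$ and $c_0=c_0(\mathbb N)$ are over $\mathbb K\in\{\mathbb R,\mathbb C\}$ with their usual norms. $N\ge2$. For $D\subseteq\mathbb N$, $\overline{dens}(D)=\limsup_{n\to\infty}\frac{card(D\cap[1,n])}{n}$. $D_\infty(T)=\bigcap_{n\in\mathbb N}D(T^n)$. $T_1,\dots,T_N$ are densely $(d,1)$-distributionally chaotic iff there exist an uncountable set $S\subseteq\bigcap_{j=1}^ND_\infty(T_j)$, dense in $X$, and $\sigma>0$ such that for each $\epsilon>0$ and each pair $x,y\in S$ of distinct points, $\overline{dens}\big(\bigcap_{1\le j\le N}\{k:\|T_j^kx-T_j^ky\|\ge\sigma\}\big)=1$ and $\overline{dens}\big(\bigcap_{1\le j\le N}\{k:\|T_j^kx-T_j^ky\|<\epsilon\}\big)=1$. *)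

theory Defs
  imports "HOL-Analysis.Analysis"
begin

text \<open>
  Sequences are functions on \<^typ>\<open>nat\<close>, so the coordinates indexed by 1, 2, 3, ... in the
  mathematical text are indexed by 0, 1, 2, ... here (for sequences, weights and the
  auxiliary sequence alike). Iteration counts of an operator and the upper density are not
  renumbered: they still range over 1, 2, 3, ...

  The scalar field is a type of sort \<open>{real_normed_field, euclidean_space}\<close>, which has the
  instances \<^typ>\<open>real\<close> and \<^typ>\<open>complex\<close> and, by the Frobenius theorem, no others up to
  isometric isomorphism.
\<close>

datatype seq_space = Lp real | C0

fun seq_carrier :: "seq_space \<Rightarrow> (nat \<Rightarrow> 'a::real_normed_vector) set" where
  "seq_carrier (Lp p) = {x. summable (\<lambda>n. norm (x n) powr p)}"
| "seq_carrier C0 = {x. x \<longlonglongrightarrow> 0}"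

fun seq_norm :: "seq_space \<Rightarrow> (nat \<Rightarrow> 'a::real_normed_vector) \<Rightarrow> real" where
  "seq_norm (Lp p) x = (\<Sum>n. norm (x n) powr p) powr (1 / p)"
| "seq_norm C0 x = (SUP n. norm (x n))"

definition upper_density :: "nat set \<Rightarrow> ereal" where
  "upper_density D = limsup (\<lambda>n. ereal (real (card (D \<inter> {1..n})) / real n))"

text \<open>
  A possibly unbounded operator in a space with carrier \<open>X\<close> is given by its domain \<open>D\<close> and a
  total function \<open>T\<close>, whose values outside \<open>D\<close> are irrelevant.
\<close>

fun dom_power :: "'v set \<Rightarrow> 'v set \<Rightarrow> ('v \<Rightarrow> 'v) \<Rightarrow> nat \<Rightarrow> 'v set" where
  "dom_power X D T 0 = X"
| "dom_power X D T (Suc n) = {x \<in> dom_power X D T n. (T ^^ n) x \<in> D}"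

definition dom_infty :: "'v set \<Rightarrow> 'v set \<Rightarrow> ('v \<Rightarrow> 'v) \<Rightarrow> 'v set" where
  "dom_infty X D T = (\<Inter>n. dom_power X D T n)"

definition densely_d1_distributionally_chaotic ::
  "'v::minus set \<Rightarrow> ('v \<Rightarrow> real) \<Rightarrow> nat \<Rightarrow> (nat \<Rightarrow> 'v set) \<Rightarrow> (nat \<Rightarrow> 'v \<Rightarrow> 'v) \<Rightarrow> bool" where
  "densely_d1_distributionally_chaotic X nrm N D T \<longleftrightarrow>
    (\<exists>S \<sigma>. uncountable S
      \<and> S \<subseteq> (\<Inter>j\<in>{1..N}. dom_infty X (D j) (T j))
      \<and> (\<forall>x\<in>X. \<forall>\<delta>>0. \<exists>s\<in>S. nrm (x - s) < \<delta>)
      \<and> \<sigma> > 0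
      \<and> (\<forall>\<epsilon>>0. \<forall>x\<in>S. \<forall>y\<in>S. x \<noteq> y \<longrightarrow>
           upper_density (\<Inter>j\<in>{1..N}. {k. nrm ((T j ^^ k) x - (T j ^^ k) y) \<ge> \<sigma>}) = 1
         \<and> upper_density (\<Inter>j\<in>{1..N}. {k. nrm ((T j ^^ k) x - (T j ^^ k) y) < \<epsilon>}) = 1))"

definition weighted_shift ::
  "(nat \<Rightarrow> real) \<Rightarrow> (nat \<Rightarrow> 'a::real_normed_vector) \<Rightarrow> (nat \<Rightarrow> 'a)" where
  "weighted_shift w x = (\<lambda>n. w n *\<^sub>R x (Suc n))"

definition weighted_shift_dom ::
  "seq_space \<Rightarrow> (nat \<Rightarrow> real) \<Rightarrow> (nat \<Rightarrow> 'a::real_normed_vector) set" where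
  "weighted_shift_dom X w = {x \<in> seq_carrier X. weighted_shift w x \<in> seq_carrier X}"

definition shift_term :: "(nat \<Rightarrow> real) \<Rightarrow> (nat \<Rightarrow> real) \<Rightarrow> nat \<Rightarrow> nat \<Rightarrow> real" where
  "shift_term a w k n = a (k + n) * (\<Prod>i\<in>{n..<k + n}. w i)"

text \<open>The supremum below is only meaningful when the terms are bounded above.\<close>

definition shift_bound :: "(nat \<Rightarrow> real) \<Rightarrow> (nat \<Rightarrow> real) \<Rightarrow> nat \<Rightarrow> real" where
  "shift_bound a w k = (SUP n. shift_term a w k n)"

end

theory Submission
  imports Defs
begin

text \<open>
  For a backward shift, \<open>T ^^ k\<close> annihilates every sequence supported below \<open>k\<close>; so times
  \<open>k \<ge> s\<close> only see coordinates from \<open>s\<close> on, while coordinates very far out contribute almost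
  nothing at any fixed time. A vector made of blocks of coordinates can therefore be large
  along the orbit during one period and small during another, with no interference, and all the
  shifts \<open>T 1, \<dots>, T N\<close> can share the same blocks.

  \<^item> \<^emph>\<open>Continuity.\<close> Let \<open>B j k\<close> be the supremum in the hypothesis. If \<open>\<bar>x m\<bar> \<le> a m * \<bar>y m\<bar>\<close> with
    \<open>y\<close> in the space, then the whole orbit of \<open>x\<close> stays in the space and
    \<open>\<parallel>(T j ^^ k) x\<parallel> \<le> B j k * \<parallel>y\<parallel>\<close> (\<open>orbit_bound\<close>). The vectors used below are all of this kind.

  \<^item> \<^emph>\<open>Growth.\<close> The supremum \<open>B j k\<close> is attained up to a factor \<open>2\<close> at some position
    \<open>n j k\<close>, so the coordinate \<open>n j k\<close> of \<open>(T j ^^ k) (a * y)\<close> is at least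
    \<open>B j k / 2 * y (k + n j k)\<close>. Summability of \<open>1 / B j k ^ q\<close> is what allows a nonnegative \<open>y\<close>
    in \<open>l\<^sup>q\<close> for which these numbers tend to infinity: let \<open>y ^ q\<close> have at \<open>k + n j k\<close> the
    mass \<open>c k / B j k ^ q\<close>, where \<open>c\<close> tends to infinity so slowly that the series still converges
    (\<open>spread_summable\<close>, \<open>ex_profile\<close>). The first case of the theorem is \<open>q = 1\<close>, with
    \<open>l\<^sup>1\<close> contained in all the spaces; the second is \<open>q = 2\<close>. The norm of an orbit is
    always estimated from below by a single coordinate.

  \<^item> \<^emph>\<open>Irregularity.\<close> Choose \<open>s 0 < s 1 < \<dots>\<close> so sparse that the times up to \<open>(r + 1) * s r\<close>
    reach their positions \<open>k + n j k\<close> before \<open>s (r + 1)\<close>, and hardly see the coordinates beyond.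
    Let \<open>z\<close> be \<open>a * y\<close> restricted to the blocks \<open>{s r..<s (r + 1)}\<close> with \<open>r\<close> even. For times in
    \<open>{s r..(r + 1) * s r}\<close> the orbits of \<open>z\<close> are large if \<open>r\<close> is even and small if \<open>r\<close> is odd
    (\<open>ex_irregular_vector\<close>), and each of these two sets of times has upper density 1.

  \<^item> \<^emph>\<open>The scrambled set.\<close> Take all \<open>v c + c *\<^sub>R z\<close> with \<open>c\<close> real, where each \<open>v c\<close> is finitely
    supported. The difference of two of them is eventually mapped to the same vectors as
    \<open>(c - c') *\<^sub>R z\<close>, so it inherits the irregularity of \<open>z\<close>. The set becomes dense if every member
    of a countable dense family of finitely supported sequences occurs as \<open>v c\<close> for
    arbitrarily small \<open>c > 0\<close>.
\<close>

section \<open>The sequence spaces\<close>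

definition classical_space :: "seq_space \<Rightarrow> bool" where
  "classical_space X \<longleftrightarrow> (\<exists>p\<ge>1. X = Lp p) \<or> X = C0"

lemma classical_space_cases:
  assumes "classical_space X"
  obtains (Lp) p where "p \<ge> 1" "X = Lp p" | (C0) "X = C0"
  using assms by (auto simp: classical_space_def)

lemma bdd_above_null_seq:
  fixes x :: "nat \<Rightarrow> 'a::real_normed_vector"
  assumes "x \<longlonglongrightarrow> 0"
  shows "bdd_above (range (\<lambda>n. norm (x n)))"
proof -
  have "Bseq x" using assms convergentI convergent_imp_Bseq by blast
  then show ?thesis
    unfolding Bseq_def bdd_above_def by blast
qed

text \<open>
  Monotonicity of the norm, scaling and boundedness of the unweighted shift in one estimate;
  this form is what the orbits of weighted shifts need.
\<close>

lemma seq_shift_dominated: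
  fixes x :: "nat \<Rightarrow> 'a::real_normed_vector" and y :: "nat \<Rightarrow> 'b::real_normed_vector"
  assumes X: "classical_space X" and x: "x \<in> seq_carrier X" and C: "C \<ge> 0"
    and le: "\<And>n. norm (y n) \<le> C * norm (x (n + k))"
  shows "y \<in> seq_carrier X" and "seq_norm X y \<le> C * seq_norm X x"
proof -
  have "y \<in> seq_carrier X \<and> seq_norm X y \<le> C * seq_norm X x"
    using X
  proof (cases rule: classical_space_cases)
    case (Lp p)
    define f where "f = (\<lambda>n. norm (x n) powr p)"
    have sf: "summable f" using x Lp by (simp add: f_def)
    have sfk: "summable (\<lambda>n. f (n + k))" using sf by (simp add: summable_iff_shift)
    have le': "norm (y n) powr p \<le> C powr p * f (n + k)" for n
    proof -
      have "norm (y n) powr p \<le> (C * norm (x (n + k))) powr p"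
        using le Lp by (intro powr_mono2) auto
      also have "\<dots> = C powr p * f (n + k)"
        using C by (simp add: powr_mult f_def)
      finally show ?thesis .
    qed
    have sy: "summable (\<lambda>n. norm (y n) powr p)"
      by (rule summable_comparison_test'[OF summable_mult[OF sfk, of "C powr p"]])
        (use le' in auto)
    have "(\<Sum>n. norm (y n) powr p) \<le> (\<Sum>n. C powr p * f (n + k))"
      by (rule suminf_le[OF le' sy summable_mult[OF sfk]])
    also have "\<dots> = C powr p * (\<Sum>n. f (n + k))"
      using sfk by (rule suminf_mult)
    also have "(\<Sum>n. f (n + k)) \<le> suminf f"
      using suminf_split_initial_segment[OF sf, of k] sum_nonneg[of "{..<k}" f]
      by (simp add: f_def)
    finally have "(\<Sum>n. norm (y n) powr p) \<le> C powr p * suminf f"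
      by (simp add: mult_left_mono)
    then have "(\<Sum>n. norm (y n) powr p) powr (1 / p) \<le> (C powr p * suminf f) powr (1 / p)"
      using Lp sy by (intro powr_mono2) (auto intro: suminf_nonneg)
    also have "\<dots> = C * suminf f powr (1 / p)"
      using Lp C sf by (simp add: powr_mult powr_powr suminf_nonneg f_def)
    finally show ?thesis using sy Lp by (simp add: f_def)
  next
    case C0
    have x0: "x \<longlonglongrightarrow> 0" using x C0 by simp
    have "(\<lambda>n. norm (x (n + k))) \<longlonglongrightarrow> 0"
      using LIMSEQ_ignore_initial_segment[OF tendsto_norm_zero[OF x0]] .
    then have "(\<lambda>n. C * norm (x (n + k))) \<longlonglongrightarrow> 0"
      by (rule tendsto_mult_right_zero)
    then have "y \<longlonglongrightarrow> 0"
      by (rule Lim_null_comparison[rotated]) (use le in auto)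
    moreover have "(SUP n. norm (y n)) \<le> C * (SUP n. norm (x n))"
    proof (rule cSUP_least)
      fix n
      have "norm (y n) \<le> C * norm (x (n + k))" by (rule le)
      also have "\<dots> \<le> C * (SUP n. norm (x n))"
        by (intro mult_left_mono cSUP_upper bdd_above_null_seq[OF x0] C) auto
      finally show "norm (y n) \<le> C * (SUP n. norm (x n))" .
    qed simp
    ultimately show ?thesis using C0 by simp
  qed
  then show "y \<in> seq_carrier X" and "seq_norm X y \<le> C * seq_norm X x" by auto
qed

lemma norm_coordinate_le_seq_norm:
  fixes x :: "nat \<Rightarrow> 'a::real_normed_vector"
  assumes X: "classical_space X" and x: "x \<in> seq_carrier X"
  shows "norm (x n) \<le> seq_norm X x"
  using X
proof (cases rule: classical_space_cases)
  case (Lp p)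
  have s: "summable (\<lambda>n. norm (x n) powr p)" using x Lp by simp
  have "norm (x n) powr p \<le> (\<Sum>n. norm (x n) powr p)"
    using sum_le_suminf[OF s, of "{n}"] by simp
  then have "(norm (x n) powr p) powr (1 / p) \<le> (\<Sum>n. norm (x n) powr p) powr (1 / p)"
    using Lp by (intro powr_mono2) auto
  then show ?thesis using Lp by (simp add: powr_powr)
next
  case C0
  then have "x \<longlonglongrightarrow> 0" using x by simp
  then have "norm (x n) \<le> (SUP n. norm (x n))"
    by (intro cSUP_upper bdd_above_null_seq) auto
  then show ?thesis using C0 by simp
qed

lemma seq_norm_nonneg:
  assumes "classical_space X" and "x \<in> seq_carrier X"
  shows "seq_norm X x \<ge> 0"
  using norm_coordinate_le_seq_norm[OF assms, of 0] norm_ge_zero[of "x 0"] by linarith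

text \<open>
  A triangle inequality up to the factor 4 is enough, since the inequality only serves for
  density. It follows from \<open>\<bar>u + v\<bar> \<le> 2 * max \<bar>u\<bar> \<bar>v\<bar>\<close> in every coordinate.
\<close>

lemma seq_add:
  fixes x y :: "nat \<Rightarrow> 'a::real_normed_vector"
  assumes X: "classical_space X" and x: "x \<in> seq_carrier X" and y: "y \<in> seq_carrier X"
  shows "(\<lambda>n. x n + y n) \<in> seq_carrier X"
    and "seq_norm X (\<lambda>n. x n + y n) \<le> 4 * (seq_norm X x + seq_norm X y)"
proof -
  have "(\<lambda>n. x n + y n) \<in> seq_carrier X
      \<and> seq_norm X (\<lambda>n. x n + y n) \<le> 4 * (seq_norm X x + seq_norm X y)"
    using X
  proof (cases rule: classical_space_cases)
    case (Lp p)
    define f where "f = (\<lambda>n. norm (x n) powr p)"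
    define g where "g = (\<lambda>n. norm (y n) powr p)"
    have sf: "summable f" and sg: "summable g" using x y Lp by (simp_all add: f_def g_def)
    have nn: "suminf f \<ge> 0" "suminf g \<ge> 0"
      using sf sg by (auto intro!: suminf_nonneg simp: f_def g_def)
    have le: "norm (x n + y n) powr p \<le> 2 powr p * (f n + g n)" for n
    proof -
      have "norm (x n + y n) powr p \<le> (2 * max (norm (x n)) (norm (y n))) powr p"
        using Lp norm_triangle_ineq[of "x n" "y n"] by (intro powr_mono2) auto
      also have "\<dots> = 2 powr p * max (norm (x n)) (norm (y n)) powr p"
        by (simp add: powr_mult)
      also have "max (norm (x n)) (norm (y n)) powr p \<le> f n + g n"
        by (simp add: f_def g_def max_def)
      finally show ?thesis by simp
    qed
    have sfg: "summable (\<lambda>n. 2 powr p * (f n + g n))"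
      by (intro summable_mult summable_add sf sg)
    have s: "summable (\<lambda>n. norm (x n + y n) powr p)"
      by (rule summable_comparison_test'[OF sfg]) (use le in auto)
    have "(\<Sum>n. norm (x n + y n) powr p) \<le> (\<Sum>n. 2 powr p * (f n + g n))"
      by (rule suminf_le[OF le s sfg])
    also have "\<dots> = 2 powr p * (suminf f + suminf g)"
      using sf sg by (simp add: suminf_mult summable_add suminf_add)
    also have "\<dots> \<le> 2 powr p * (2 powr p * max (suminf f) (suminf g))"
    proof (intro mult_left_mono)
      have "2 powr 1 \<le> 2 powr p" using Lp by (intro powr_mono) auto
      then have "2 * max (suminf f) (suminf g) \<le> 2 powr p * max (suminf f) (suminf g)"
        using nn by (intro mult_right_mono) auto
      then show "suminf f + suminf g \<le> 2 powr p * max (suminf f) (suminf g)"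
        by linarith
    qed simp
    finally have "(\<Sum>n. norm (x n + y n) powr p) powr (1 / p)
        \<le> (2 powr p * (2 powr p * max (suminf f) (suminf g))) powr (1 / p)"
      using Lp s by (intro powr_mono2) (auto intro: suminf_nonneg)
    also have "\<dots> = 4 * max (suminf f) (suminf g) powr (1 / p)"
      using Lp nn by (simp add: powr_mult powr_powr)
    also have "\<dots> \<le> 4 * (suminf f powr (1 / p) + suminf g powr (1 / p))"
      by (simp add: max_def)
    finally show ?thesis using s Lp by (simp add: f_def g_def)
  next
    case C0
    have x0: "x \<longlonglongrightarrow> 0" and y0: "y \<longlonglongrightarrow> 0" using x y C0 by simp_all
    have "norm (x n + y n) \<le> 4 * ((SUP n. norm (x n)) + (SUP n. norm (y n)))" for n
    proof -
      have "norm (x n) \<le> (SUP n. norm (x n))" "norm (y n) \<le> (SUP n. norm (y n))"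
        by (intro cSUP_upper bdd_above_null_seq x0 y0; simp)+
      then show ?thesis
        using norm_triangle_ineq[of "x n" "y n"] norm_ge_zero[of "x n"] norm_ge_zero[of "y n"]
        by argo
    qed
    then have "(SUP n. norm (x n + y n)) \<le> 4 * ((SUP n. norm (x n)) + (SUP n. norm (y n)))"
      by (intro cSUP_least) auto
    then show ?thesis using C0 tendsto_add[OF x0 y0] by simp
  qed
  then show "(\<lambda>n. x n + y n) \<in> seq_carrier X"
    and "seq_norm X (\<lambda>n. x n + y n) \<le> 4 * (seq_norm X x + seq_norm X y)" by auto
qed

lemma seq_norm_add_less:
  fixes x y :: "nat \<Rightarrow> 'a::real_normed_vector"
  assumes X: "classical_space X" and x: "x \<in> seq_carrier X" and y: "y \<in> seq_carrier X"
    and "seq_norm X x < \<delta> / 8" and "seq_norm X y < \<delta> / 8"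
  shows "seq_norm X (\<lambda>n. x n + y n) < \<delta>"
  using seq_add(2)[OF X x y] assms(4,5) by simp

lemma summable_in_seq_carrier:
  assumes X: "classical_space X" and s: "summable (\<lambda>n. norm (x n))"
  shows "x \<in> seq_carrier X"
  using X
proof (cases rule: classical_space_cases)
  case (Lp p)
  have "(\<lambda>n. norm (x n)) \<longlonglongrightarrow> 0" using s by (rule summable_LIMSEQ_zero)
  then have "eventually (\<lambda>n. norm (x n) < 1) sequentially"
    by (rule order_tendstoD) simp
  then obtain M where M: "\<And>n. n \<ge> M \<Longrightarrow> norm (x n) < 1"
    by (auto simp: eventually_sequentially)
  have "summable (\<lambda>n. norm (x n) powr p)"
  proof (rule summable_comparison_test'[OF s, of M])
    fix n assume "n \<ge> M"
    have "norm (x n) powr p \<le> norm (x n) powr 1"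
      using M[OF \<open>n \<ge> M\<close>] Lp by (intro powr_mono') auto
    then show "norm (norm (x n) powr p) \<le> norm (x n)" by simp
  qed
  then show ?thesis using Lp by simp
next
  case C0
  then show ?thesis using summable_LIMSEQ_zero[OF s] by (simp add: tendsto_norm_zero_iff)
qed

lemma finite_support_in_seq_carrier:
  assumes X: "classical_space X" and z: "\<And>n. n \<ge> M \<Longrightarrow> x n = 0"
  shows "x \<in> seq_carrier X"
proof (rule summable_in_seq_carrier[OF X])
  show "summable (\<lambda>n. norm (x n))"
    by (rule summable_finite[of "{..<M}"]) (use z in \<open>auto simp: not_less\<close>)
qed

lemma seq_norm_tail_tendsto_0:
  fixes x :: "nat \<Rightarrow> 'a::real_normed_vector"
  assumes X: "classical_space X" and x: "x \<in> seq_carrier X"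
  shows "(\<lambda>s. seq_norm X (\<lambda>n. if n < s then 0 else x n)) \<longlonglongrightarrow> 0"
  using X
proof (cases rule: classical_space_cases)
  case (Lp p)
  define f where "f = (\<lambda>n. norm (x n) powr p)"
  have sf: "summable f" using x Lp by (simp add: f_def)
  have tail: "(\<Sum>n. norm (if n < s then 0 else x n) powr p) = suminf f - sum f {..<s}" for s
  proof -
    define g where "g = (\<lambda>n. if n < s then 0 else f n)"
    have "summable (\<lambda>n. g (n + s))" using sf by (simp add: g_def summable_iff_shift)
    then have "summable g" by (simp add: summable_iff_shift)
    then have "suminf g = (\<Sum>n. g (n + s)) + sum g {..<s}"
      by (rule suminf_split_initial_segment)
    also have "\<dots> = (\<Sum>n. f (n + s))" by (simp add: g_def)
    also have "\<dots> = suminf f - sum f {..<s}"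
      using suminf_split_initial_segment[OF sf, of s] by simp
    also have "g = (\<lambda>n. norm (if n < s then 0 else x n) powr p)"
      by (auto simp: g_def f_def)
    finally show ?thesis .
  qed
  have "(\<lambda>s. suminf f - sum f {..<s}) \<longlonglongrightarrow> suminf f - suminf f"
    by (intro tendsto_intros summable_LIMSEQ sf)
  then have "(\<lambda>s. (suminf f - sum f {..<s}) powr (1 / p)) \<longlonglongrightarrow> 0"
    using Lp by (intro tendsto_zero_powrI) (auto intro!: tendsto_const always_eventually sum_le_suminf sf, auto simp: f_def)
  then show ?thesis using Lp tail by simp
next
  case C0
  have x0: "x \<longlonglongrightarrow> 0" using x C0 by simp
  show ?thesis
  proof (rule LIMSEQ_I)
    fix r :: real assume r: "r > 0"
    then obtain M where M: "\<And>n. n \<ge> M \<Longrightarrow> norm (x n) < r / 2"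
      using LIMSEQ_D[OF x0, of "r/2"] by auto
    have "norm (seq_norm X (\<lambda>n. if n < s then 0 else x n) - 0) < r" if s: "s \<ge> M" for s
    proof -
      have t: "(\<lambda>n. if n < s then 0 else x n) \<in> seq_carrier X"
        by (rule seq_shift_dominated(1)[OF X x, of 1 _ 0]) auto
      have "(SUP n. norm (if n < s then 0 else x n)) \<le> r / 2"
        using M r s by (intro cSUP_least) (auto simp: not_less less_imp_le)
      then have "seq_norm X (\<lambda>n. if n < s then 0 else x n) \<le> r / 2" using C0 by simp
      moreover have "seq_norm X (\<lambda>n. if n < s then 0 else x n) \<ge> 0"
        using seq_norm_nonneg[OF X t] .
      ultimately show ?thesis using r by simp
    qed
    then show "\<exists>no. \<forall>n\<ge>no. norm (seq_norm X (\<lambda>na. if na < n then 0 else x na) - 0) < r"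
      by blast
  qed
qed

text \<open>
  Cut off the tail and approximate the remaining coordinates by elements of \<open>D\<close>. Lists keep
  the approximating family countable when \<open>D\<close> is.
\<close>

lemma finite_sequences_dense:
  fixes x :: "nat \<Rightarrow> 'a::real_normed_vector"
  assumes X: "classical_space X" and x: "x \<in> seq_carrier X" and \<delta>: "\<delta> > 0"
    and D: "\<And>U. open U \<Longrightarrow> U \<noteq> {} \<Longrightarrow> \<exists>d\<in>D. d \<in> U"
  shows "\<exists>l\<in>lists D. (\<lambda>n. x n - nth_default 0 l n) \<in> seq_carrier X
           \<and> seq_norm X (\<lambda>n. x n - nth_default 0 l n) < \<delta>"
proof -
  have "eventually (\<lambda>s. seq_norm X (\<lambda>n. if n < s then 0 else x n) < \<delta> / 8) sequentially"
    using seq_norm_tail_tendsto_0[OF X x] \<delta> by (intro order_tendstoD) auto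
  then obtain M where M: "seq_norm X (\<lambda>n. if n < M then 0 else x n) < \<delta> / 8"
    by (auto simp: eventually_sequentially)
  define u :: "nat \<Rightarrow> real" where "u n = (if n < M then 1 else 0)" for n
  have u: "u \<in> seq_carrier X"
    by (rule finite_support_in_seq_carrier[OF X, of M]) (simp add: u_def)
  have nu: "seq_norm X u \<ge> 0" by (rule seq_norm_nonneg[OF X u])
  define \<eta> where "\<eta> = \<delta> / (8 * (seq_norm X u + 1))"
  have \<eta>: "\<eta> > 0" using nu \<delta> by (simp add: \<eta>_def)
  have "\<exists>d\<in>D. d \<in> ball (x n) \<eta>" for n
    using \<eta> by (intro D) auto
  then obtain d where d: "\<And>n. d n \<in> D" "\<And>n. dist (x n) (d n) < \<eta>"
    by (metis mem_ball)
  define l where "l = map d [0..<M]"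
  have l: "l \<in> lists D" using d by (auto simp: l_def)
  have nl: "nth_default 0 l n = (if n < M then d n else 0)" for n
    by (simp add: l_def nth_default_def)
  define v where "v n = (if n < M then x n - d n else 0)" for n
  have "norm (v n) \<le> \<eta> * norm (u (n + 0))" for n
    using d(2)[of n] by (auto simp: v_def u_def dist_norm less_imp_le)
  from seq_shift_dominated[OF X u _ this] \<eta>
  have v: "v \<in> seq_carrier X" and nv: "seq_norm X v \<le> \<eta> * seq_norm X u" by auto
  note nv
  also have "\<eta> * seq_norm X u < \<eta> * (seq_norm X u + 1)" using \<eta> by simp
  also have "\<dots> = \<delta> / 8" using nu by (simp add: \<eta>_def field_simps)
  finally have nv': "seq_norm X v < \<delta> / 8" .
  define t where "t n = (if n < M then 0 else x n)" for n
  have t: "t \<in> seq_carrier X"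
    by (rule seq_shift_dominated(1)[OF X x, of 1 _ 0]) (auto simp: t_def)
  have nt: "seq_norm X t < \<delta> / 8" using M by (simp add: t_def[abs_def])
  have eq: "(\<lambda>n. x n - nth_default 0 l n) = (\<lambda>n. v n + t n)"
    by (auto simp: nl v_def t_def)
  have "seq_norm X (\<lambda>n. x n - nth_default 0 l n) < \<delta>"
    unfolding eq by (rule seq_norm_add_less[OF X v t nv' nt])
  moreover have "(\<lambda>n. x n - nth_default 0 l n) \<in> seq_carrier X"
    unfolding eq using seq_add(1)[OF X v t] .
  ultimately show ?thesis using l by blast
qed

section \<open>Spreading a convergent series over prescribed positions\<close>

text \<open>
  With \<open>r k\<close> the \<open>k\<close>-th remainder of the series, \<open>c k = 1 / sqrt (r k)\<close> works:
  \<open>\<beta> k = r k - r (k + 1)\<close> factors as a difference of squares, so \<open>c k * \<beta> k\<close> is bounded by twice a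
  telescoping difference of \<open>sqrt (r k)\<close>.
\<close>

lemma summable_with_divergent_factor:
  fixes \<beta> :: "nat \<Rightarrow> real"
  assumes s: "summable \<beta>" and pos: "\<And>k. \<beta> k > 0"
  obtains c where "\<And>k. c k > 0" "filterlim c at_top sequentially" "summable (\<lambda>k. c k * \<beta> k)"
proof
  define r where "r k = suminf \<beta> - sum \<beta> {..<k}" for k
  have r_pos: "r k > 0" for k
    using sum_less_suminf[OF s, of k] pos by (simp add: r_def)
  have r_Suc: "r k - r (Suc k) = \<beta> k" for k by (simp add: r_def)
  have "r \<longlonglongrightarrow> suminf \<beta> - suminf \<beta>"
    unfolding r_def by (intro tendsto_intros summable_LIMSEQ s)
  then have r0: "r \<longlonglongrightarrow> 0" by simp
  define c where "c k = inverse (sqrt (r k))" for k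
  show "c k > 0" for k using r_pos by (simp add: c_def)
  have "(\<lambda>k. sqrt (r k)) \<longlonglongrightarrow> 0" using tendsto_real_sqrt[OF r0] by simp
  then show "filterlim c at_top sequentially"
    unfolding c_def using r_pos
    by (intro filterlim_inverse_at_top) auto
  have le: "c k * \<beta> k \<le> 2 * (sqrt (r k) - sqrt (r (Suc k)))" for k
  proof -
    have dec: "sqrt (r (Suc k)) \<le> sqrt (r k)"
      using r_Suc[of k] pos[of k] by (intro real_sqrt_le_mono) linarith
    have "\<beta> k = (sqrt (r k) - sqrt (r (Suc k))) * (sqrt (r k) + sqrt (r (Suc k)))"
      using r_Suc[of k] r_pos[of k] r_pos[of "Suc k"] by (simp add: algebra_simps)
    also have "\<dots> \<le> (sqrt (r k) - sqrt (r (Suc k))) * (2 * sqrt (r k))"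
      using dec by (intro mult_left_mono) auto
    finally show ?thesis using r_pos[of k] by (simp add: c_def field_simps)
  qed
  have "summable (\<lambda>k. sqrt (r k) - sqrt (r (Suc k)))"
    using telescope_summable'[OF \<open>(\<lambda>k. sqrt (r k)) \<longlonglongrightarrow> 0\<close>] .
  then show "summable (\<lambda>k. c k * \<beta> k)"
    by (rule summable_comparison_test'[OF summable_mult[of _ 2]])
      (use le pos \<open>\<And>k. c k > 0\<close> in \<open>simp add: less_imp_le\<close>)
qed

text \<open>
  The mass \<open>c k * \<beta> k\<close> of the previous lemma is moved from \<open>k\<close> to the position \<open>m k\<close>. The map \<open>m\<close>
  may fail to be injective; \<open>k \<le> m k\<close> makes every position collect only finitely many masses.
\<close>

lemma spread_summable:
  fixes \<beta> :: "nat \<Rightarrow> real" and m :: "nat \<Rightarrow> nat"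
  assumes s: "summable \<beta>" and pos: "\<And>k. \<beta> k > 0" and m: "\<And>k. k \<le> m k"
  obtains u where "\<And>i. u i \<ge> 0" "summable u"
    "filterlim (\<lambda>k. u (m k) / \<beta> k) at_top sequentially"
proof -
  obtain c where c: "\<And>k. c k > 0" "filterlim c at_top sequentially"
    and sc: "summable (\<lambda>k. c k * \<beta> k)"
    using summable_with_divergent_factor[OF s pos] by metis
  define b where "b k = c k * \<beta> k" for k
  have b: "b k > 0" for k using c pos by (simp add: b_def)
  define u where "u i = (\<Sum>k | k \<le> i \<and> m k = i. b k)" for i
  have u: "u i \<ge> 0" for i
    unfolding u_def using b by (intro sum_nonneg) (auto intro: less_imp_le)
  have "summable u"
  proof (rule summableI_nonneg_bounded[OF u])
    fix n
    \<comment> \<open>Masses that land below \<open>n\<close> also start below \<open>n\<close>, so the double sum regroups a part of \<open>b\<close>.\<close>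
    have "sum u {..<n} = (\<Sum>i<n. \<Sum>k | k \<in> {k. k < n \<and> m k < n} \<and> m k = i. b k)"
      unfolding u_def
      using m by (intro sum.cong refl) (auto intro: le_less_trans)
    also have "\<dots> = sum b {k. k < n \<and> m k < n}"
      by (rule sum.group) auto
    also have "\<dots> \<le> suminf b"
      using sc b by (intro sum_le_suminf) (auto simp: b_def[abs_def] less_imp_le)
    finally show "sum u {..<n} \<le> suminf b" .
  qed
  moreover have "filterlim (\<lambda>k. u (m k) / \<beta> k) at_top sequentially"
  proof (rule filterlim_at_top_mono[OF c(2)], rule always_eventually, rule allI)
    fix k
    have "b k \<le> u (m k)"
      unfolding u_def using m b by (intro member_le_sum) (auto simp: less_imp_le)
    then show "c k \<le> u (m k) / \<beta> k" using pos[of k] by (simp add: b_def field_simps)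
  qed
  ultimately show ?thesis using that u by blast
qed

section \<open>Upper density\<close>

text \<open>
  At \<open>n = (r + 1) * s r\<close> the interval covers the proportion \<open>r / (r + 1)\<close> of \<open>{1..n}\<close>.
\<close>

lemma upper_density_1_if_long_intervals:
  fixes s \<rho> :: "nat \<Rightarrow> nat"
  assumes s: "strict_mono s" "s 0 \<ge> 1" and \<rho>: "strict_mono \<rho>"
    and sub: "\<And>k. {s (\<rho> k)..Suc (\<rho> k) * s (\<rho> k)} \<subseteq> D"
  shows "upper_density D = 1"
proof (rule antisym)
  define d where "d n = real (card (D \<inter> {1..n})) / real n" for n
  have "d n \<le> 1" for n
    using card_mono[of "{1..n}" "D \<inter> {1..n}"] by (simp add: d_def divide_le_eq)
  then show "upper_density D \<le> 1"
    unfolding upper_density_def d_def by (intro Limsup_bounded always_eventually) simp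
  define n where "n k = Suc (\<rho> k) * s (\<rho> k)" for k
  have n: "strict_mono n"
  proof (rule strict_mono_Suc_iff[THEN iffD2], rule allI)
    fix k
    have "\<rho> k < \<rho> (Suc k)" using \<rho> by (simp add: strict_mono_def)
    moreover have "s (\<rho> k) < s (\<rho> (Suc k))" using s(1) calculation by (simp add: strict_mono_def)
    ultimately show "n k < n (Suc k)" unfolding n_def by (intro mult_strict_mono) auto
  qed
  have lower: "1 - inverse (real (Suc k)) \<le> d (n k)" for k
  proof -
    have sk: "s (\<rho> k) \<ge> 1" using s strict_mono_less_eq[OF s(1), of 0 "\<rho> k"] by linarith
    have "{s (\<rho> k)..n k} \<subseteq> D \<inter> {1..n k}" using sub[of k] sk by (auto simp: n_def)
    then have "card {s (\<rho> k)..n k} \<le> card (D \<inter> {1..n k})" by (intro card_mono) auto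
    then have "\<rho> k * s (\<rho> k) \<le> card (D \<inter> {1..n k})" by (simp add: n_def)
    then have "real (\<rho> k) * real (s (\<rho> k)) \<le> real (card (D \<inter> {1..n k}))"
      by (metis of_nat_le_iff of_nat_mult)
    moreover have "1 - inverse (real (Suc (\<rho> k))) = real (\<rho> k) * real (s (\<rho> k)) / real (n k)"
    proof -
      have "real (\<rho> k) * real (s (\<rho> k)) / real (n k) = real (\<rho> k) / real (Suc (\<rho> k))"
        using sk unfolding n_def of_nat_mult by (intro mult_divide_mult_cancel_right) simp
      then show ?thesis by (simp add: field_simps)
    qed
    ultimately have "1 - inverse (real (Suc (\<rho> k))) \<le> d (n k)"
      by (simp add: d_def divide_right_mono)
    moreover have "inverse (real (Suc (\<rho> k))) \<le> inverse (real (Suc k))"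
      using strict_mono_imp_increasing[OF \<rho>, of k] by (intro le_imp_inverse_le) auto
    ultimately show ?thesis by linarith
  qed
  have "(\<lambda>k. ereal (1 - inverse (real (Suc k)))) \<longlonglongrightarrow> ereal (1 - 0)"
    by (intro tendsto_intros LIMSEQ_inverse_real_of_nat)
  then have "limsup (\<lambda>k. ereal (1 - inverse (real (Suc k)))) = 1"
    by (intro lim_imp_Limsup) (auto simp: one_ereal_def)
  moreover have "limsup (\<lambda>k. ereal (1 - inverse (real (Suc k)))) \<le> limsup (\<lambda>k. ereal (d (n k)))"
    using lower by (intro Limsup_mono always_eventually) simp
  moreover have "limsup (\<lambda>k. ereal (d (n k))) \<le> limsup (\<lambda>k. ereal (d k))"
    using limsup_subseq_mono[OF n, of "\<lambda>k. ereal (d k)"] by (simp add: o_def)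
  ultimately show "1 \<le> upper_density D" by (simp add: upper_density_def d_def)
qed

section \<open>Orbits of weighted backward shifts\<close>

lemma funpow_weighted_shift:
  "(weighted_shift w ^^ k) x n = (\<Prod>i\<in>{n..<k + n}. w i) *\<^sub>R x (k + n)"
proof (induction k arbitrary: n)
  case (Suc k)
  have "(\<Prod>i\<in>{n..<Suc k + n}. w i) = w n * (\<Prod>i\<in>{Suc n..<k + Suc n}. w i)"
    by (subst prod.atLeast_Suc_lessThan) auto
  moreover have "(weighted_shift w ^^ Suc k) x n = w n *\<^sub>R (weighted_shift w ^^ k) x (Suc n)"
    by (simp add: weighted_shift_def)
  ultimately show ?case by (simp only: Suc.IH) simp
qed simp

lemma dom_infty_if_orbit_in_carrier:
  assumes "\<And>k. (weighted_shift w ^^ k) x \<in> seq_carrier X"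
  shows "x \<in> dom_infty (seq_carrier X) (weighted_shift_dom X w) (weighted_shift w)"
proof -
  have "x \<in> dom_power (seq_carrier X) (weighted_shift_dom X w) (weighted_shift w) n" for n
  proof (induction n)
    case 0
    show ?case using assms[of 0] by simp
  next
    case (Suc n)
    then show ?case using assms[of n] assms[of "Suc n"] by (simp add: weighted_shift_dom_def)
  qed
  then show ?thesis by (simp add: dom_infty_def)
qed

locale dominated_shifts =
  fixes X :: seq_space and N :: nat
    and \<omega> :: "nat \<Rightarrow> nat \<Rightarrow> real" and a :: "nat \<Rightarrow> real"
  assumes X: "classical_space X"
    and weight_pos: "j \<in> {1..N} \<Longrightarrow> \<omega> j n > 0"
    and a_pos: "a n > 0"
    and bounded_a: "bounded (range a)"
    and bdd: "j \<in> {1..N} \<Longrightarrow> k \<ge> 1 \<Longrightarrow> bdd_above (range (shift_term a (\<omega> j) k))"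
begin

abbreviation B :: "nat \<Rightarrow> nat \<Rightarrow> real" where
  "B j k \<equiv> shift_bound a (\<omega> j) k"

abbreviation T :: "nat \<Rightarrow> (nat \<Rightarrow> 'a::real_normed_vector) \<Rightarrow> nat \<Rightarrow> 'a" where
  "T j \<equiv> weighted_shift (\<omega> j)"

lemma shift_term_pos: "j \<in> {1..N} \<Longrightarrow> shift_term a (\<omega> j) k n > 0"
  unfolding shift_term_def using weight_pos a_pos by (intro mult_pos_pos prod_pos) auto

text \<open>Iteration count 0 is the boundedness of \<open>a\<close>; the remaining ones are assumed.\<close>

lemma bdd_above_shift_term: "j \<in> {1..N} \<Longrightarrow> bdd_above (range (shift_term a (\<omega> j) k))"
proof (cases "k = 0")
  case True
  then have "shift_term a (\<omega> j) k = a" by (auto simp: shift_term_def)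
  then show ?thesis using bounded_a by (simp add: bounded_imp_bdd_above)
next
  case False
  then show "j \<in> {1..N} \<Longrightarrow> ?thesis" by (intro bdd) auto
qed

lemma shift_term_le: "j \<in> {1..N} \<Longrightarrow> shift_term a (\<omega> j) k n \<le> B j k"
  unfolding shift_bound_def by (intro cSUP_upper bdd_above_shift_term) auto

lemma shift_bound_pos: "j \<in> {1..N} \<Longrightarrow> B j k > 0"
  using shift_term_le[of j k 0] shift_term_pos[of j k 0] by linarith

text \<open>
  \<open>T j ^^ k\<close> maps the space weighted by \<open>1 / a\<close> boundedly into the unweighted one, with norm at
  most \<open>B j k\<close>. The comparison is required from \<open>k\<close> on only, because earlier coordinates are
  shifted out.
\<close>

lemma orbit_bound:
  fixes x :: "nat \<Rightarrow> 'a::real_normed_vector" and y :: "nat \<Rightarrow> 'b::real_normed_vector"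
  assumes j: "j \<in> {1..N}" and C: "C \<ge> 0" and y: "y \<in> seq_carrier X"
    and le: "\<And>n. n \<ge> k \<Longrightarrow> norm (x n) \<le> C * (a n * norm (y n))"
  shows "(T j ^^ k) x \<in> seq_carrier X"
    and "seq_norm X ((T j ^^ k) x) \<le> C * B j k * seq_norm X y"
proof -
  have "norm ((T j ^^ k) x n) \<le> (C * B j k) * norm (y (n + k))" for n
  proof -
    have p: "(\<Prod>i\<in>{n..<k + n}. \<omega> j i) > 0" using weight_pos j by (intro prod_pos) auto
    have "norm ((T j ^^ k) x n) = (\<Prod>i\<in>{n..<k + n}. \<omega> j i) * norm (x (k + n))"
      using p by (simp add: funpow_weighted_shift)
    also have "\<dots> \<le> (\<Prod>i\<in>{n..<k + n}. \<omega> j i) * (C * (a (k + n) * norm (y (k + n))))"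
      using p le by (intro mult_left_mono) auto
    also have "\<dots> = shift_term a (\<omega> j) k n * (C * norm (y (k + n)))"
      by (simp add: shift_term_def)
    also have "\<dots> \<le> B j k * (C * norm (y (k + n)))"
      using shift_term_le[OF j] C by (intro mult_right_mono) auto
    finally show ?thesis by (simp add: ac_simps)
  qed
  note * = seq_shift_dominated[OF X y _ this]
  have "C * B j k \<ge> 0" using C shift_bound_pos[OF j, of k] by simp
  with * show "(T j ^^ k) x \<in> seq_carrier X"
    and "seq_norm X ((T j ^^ k) x) \<le> C * B j k * seq_norm X y" by auto
qed

lemma ex_almost_maximal_position:
  obtains n where "\<And>j k. j \<in> {1..N} \<Longrightarrow> shift_term a (\<omega> j) k (n j k) \<ge> B j k / 2"
proof -
  have "\<exists>n. j \<in> {1..N} \<longrightarrow> shift_term a (\<omega> j) k n \<ge> B j k / 2" for j k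
  proof (cases "j \<in> {1..N}")
    case True
    have "B j k / 2 < (SUP n. shift_term a (\<omega> j) k n)"
      using shift_bound_pos[OF True, of k] by (simp add: shift_bound_def)
    then show ?thesis
      using less_cSUP_iff[OF _ bdd_above_shift_term[OF True], of "B j k / 2" k]
      by (auto intro: less_imp_le)
  next
    case False
    then show ?thesis by blast
  qed
  then show ?thesis using that by metis
qed

text \<open>
  The sequence \<open>y\<close> is a sum over \<open>j\<close>. Its \<open>j\<close>-th part is the \<open>q\<close>-th root of a summable
  sequence that puts a large multiple of \<open>1 / B j k ^ q\<close> at the position where \<open>B j k\<close> is almost
  attained. Adding the parts preserves the lower bounds because they are nonnegative.
\<close>

lemma ex_profile:
  assumes q: "q \<ge> (1::nat)"
    and s: "\<And>j. j \<in> {1..N} \<Longrightarrow> summable (\<lambda>k. 1 / B j (Suc k) ^ q)"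
    and embed: "\<And>y :: nat \<Rightarrow> real. (\<And>i. y i \<ge> 0) \<Longrightarrow> summable (\<lambda>i. y i ^ q) \<Longrightarrow> y \<in> seq_carrier X"
  obtains y :: "nat \<Rightarrow> real" and n where "\<And>i. y i \<ge> 0" "y \<in> seq_carrier X"
    "\<And>j. j \<in> {1..N} \<Longrightarrow>
      filterlim (\<lambda>k. shift_term a (\<omega> j) k (n j k) * y (k + n j k)) at_top sequentially"
proof -
  obtain n where n: "\<And>j k. j \<in> {1..N} \<Longrightarrow> shift_term a (\<omega> j) k (n j k) \<ge> B j k / 2"
    by (rule ex_almost_maximal_position, rule that)
  have "\<exists>y. (\<forall>i. y i \<ge> 0) \<and> y \<in> seq_carrier X \<and>
      (j \<in> {1..N} \<longrightarrow> filterlim (\<lambda>k. B j k * y (k + n j k)) at_top sequentially)" for j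
  proof (cases "j \<in> {1..N}")
    case True
    define \<beta> where "\<beta> k = 1 / B j k ^ q" for k
    have \<beta>: "\<beta> k > 0" for k using shift_bound_pos[OF True] by (simp add: \<beta>_def)
    have "summable \<beta>" using s[OF True] summable_Suc_iff[of \<beta>] by (simp add: \<beta>_def[abs_def])
    from spread_summable[OF this \<beta>, of "\<lambda>k. k + n j k"] obtain u where
      u: "\<And>i. u i \<ge> 0" "summable u"
      and lim: "filterlim (\<lambda>k. u (k + n j k) / \<beta> k) at_top sequentially" by (metis le_add1)
    define y where "y i = root q (u i)" for i
    have y: "y i \<ge> 0" for i using u q by (simp add: y_def)
    have yq: "y i ^ q = u i" for i using u q by (simp add: y_def)
    have "filterlim (\<lambda>k. B j k * y (k + n j k)) at_top sequentially"
      unfolding filterlim_at_top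
    proof
      fix Z :: real
      have "eventually (\<lambda>k. u (k + n j k) / \<beta> k \<ge> (max Z 0) ^ q) sequentially"
        using lim unfolding filterlim_at_top by blast
      then show "eventually (\<lambda>k. Z \<le> B j k * y (k + n j k)) sequentially"
      proof (rule eventually_mono)
        fix k assume "u (k + n j k) / \<beta> k \<ge> (max Z 0) ^ q"
        then have "(max Z 0) ^ q \<le> (B j k * y (k + n j k)) ^ q"
          by (simp add: \<beta>_def power_mult_distrib yq mult.commute)
        then have "max Z 0 \<le> B j k * y (k + n j k)"
          using q y shift_bound_pos[OF True, of k]
          by (intro power_mono_iff[of "max Z 0" _ q, THEN iffD1]) auto
        then show "Z \<le> B j k * y (k + n j k)" by simp
      qed
    qed
    moreover have "y \<in> seq_carrier X" using u(2) by (intro embed y) (simp add: yq)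
    ultimately show ?thesis using y by blast
  next
    case False
    then show ?thesis
      using finite_support_in_seq_carrier[OF X, of 0 "\<lambda>_. 0::real"] by (intro exI[of _ "\<lambda>_. 0"]) auto
  qed
  then obtain yy where yy: "\<And>j i. yy j i \<ge> 0" "\<And>j. yy j \<in> seq_carrier X"
    and lim: "\<And>j. j \<in> {1..N} \<Longrightarrow>
      filterlim (\<lambda>k. B j k * yy j (k + n j k)) at_top sequentially"
    by metis
  define y where "y i = (\<Sum>j\<in>{1..N}. yy j i)" for i
  have y: "y i \<ge> 0" for i using yy by (simp add: y_def sum_nonneg)
  have "(\<lambda>i. \<Sum>j\<in>J. yy j i) \<in> seq_carrier X" if "finite J" for J
    using that
  proof induction
    case empty
    show ?case using finite_support_in_seq_carrier[OF X, of 0 "\<lambda>_. 0::real"] by simp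
  next
    case (insert j J)
    then show ?case using seq_add(1)[OF X yy(2)[of j] insert.IH] by simp
  qed
  then have "y \<in> seq_carrier X" by (simp add: y_def[abs_def])
  moreover have "filterlim (\<lambda>k. shift_term a (\<omega> j) k (n j k) * y (k + n j k)) at_top sequentially"
    if j: "j \<in> {1..N}" for j
  proof -
    have "filterlim (\<lambda>k. (1/2) * (B j k * yy j (k + n j k))) at_top sequentially"
      by (rule filterlim_tendsto_pos_mult_at_top[OF tendsto_const _ lim[OF j]]) simp
    then show ?thesis
    proof (rule filterlim_at_top_mono, intro always_eventually allI)
      fix k
      have "yy j (k + n j k) \<le> y (k + n j k)"
        unfolding y_def using j yy by (intro member_le_sum) auto
      then have "B j k / 2 * yy j (k + n j k) \<le> shift_term a (\<omega> j) k (n j k) * y (k + n j k)"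
        using n[OF j, of k] yy shift_term_pos[OF j, of k "n j k"] by (intro mult_mono) auto
      then show "1/2 * (B j k * yy j (k + n j k)) \<le> shift_term a (\<omega> j) k (n j k) * y (k + n j k)"
        by simp
    qed
  qed
  ultimately show ?thesis using that y by blast
qed

text \<open>
  Each \<open>s (r + 1)\<close> has to satisfy finitely many requirements, one for every \<open>j\<close> and every
  time up to \<open>(r + 1) * s r\<close>, and each of them holds for all large values.
\<close>

lemma ex_block_boundaries:
  fixes y :: "nat \<Rightarrow> real" and n :: "nat \<Rightarrow> nat \<Rightarrow> nat"
  assumes y: "y \<in> seq_carrier X"
  obtains s :: "nat \<Rightarrow> nat" where "strict_mono s" "s 0 = 1"
    "\<And>r j i. j \<in> {1..N} \<Longrightarrow> i \<le> Suc r * s r \<Longrightarrow> i + n j i < s (Suc r)"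
    "\<And>r j i. j \<in> {1..N} \<Longrightarrow> i \<le> Suc r * s r \<Longrightarrow>
       B j i * seq_norm X (\<lambda>m. if m < s (Suc r) then 0 else y m) < 1 / real (Suc r)"
proof -
  define P where "P r s s' \<longleftrightarrow> s < s' \<and> (\<forall>j\<in>{1..N}. \<forall>i\<in>{..Suc r * s}. i + n j i < s' \<and>
       B j i * seq_norm X (\<lambda>m. if m < s' then 0 else y m) < 1 / real (Suc r))" for r s s' :: nat
  have "\<exists>s'. P r s s'" for r s
  proof -
    have "eventually (\<lambda>s'. B j i * seq_norm X (\<lambda>m. if m < s' then 0 else y m) < 1 / real (Suc r))
        sequentially" for j i
      by (rule order_tendstoD[OF tendsto_mult_right_zero[OF seq_norm_tail_tendsto_0[OF X y]]]) simp
    then have "eventually (P r s) sequentially"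
      unfolding P_def
      by (intro eventually_conj eventually_gt_at_top eventually_ball_finite ballI) auto
    then show ?thesis using eventually_happens[of "P r s" sequentially] by simp
  qed
  then obtain f where f: "\<And>r s. P r s (f r s)" by metis
  define s where "s = rec_nat 1 f"
  have s: "P r (s r) (s (Suc r))" for r using f by (simp add: s_def)
  show ?thesis
  proof
    show "strict_mono s" using s by (simp add: strict_mono_Suc_iff P_def)
    show "s 0 = 1" by (simp add: s_def)
  qed (use s in \<open>auto simp: P_def\<close>)
qed

text \<open>
  In an even period the almost maximal positions lie in a block that \<open>z\<close> occupies. In an odd
  period the coordinates that survive the shift and at which \<open>z\<close> does not vanish all have
  index at least \<open>s (r + 1)\<close>.
\<close>

lemma ex_irregular_vector:
  fixes y :: "nat \<Rightarrow> real" and n :: "nat \<Rightarrow> nat \<Rightarrow> nat"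
  assumes y: "y \<in> seq_carrier X" "\<And>i. y i \<ge> 0"
  obtains s :: "nat \<Rightarrow> nat" and z :: "nat \<Rightarrow> 'a::real_normed_field" where
    "strict_mono s" "s 0 = 1" "\<And>m. norm (z m) \<le> a m * y m"
    "\<And>r j i. even r \<Longrightarrow> j \<in> {1..N} \<Longrightarrow> i \<in> {s r..Suc r * s r} \<Longrightarrow>
       norm ((T j ^^ i) z (n j i)) = shift_term a (\<omega> j) i (n j i) * y (i + n j i)"
    "\<And>r j i. odd r \<Longrightarrow> j \<in> {1..N} \<Longrightarrow> i \<in> {s r..Suc r * s r} \<Longrightarrow>
       seq_norm X ((T j ^^ i) z) < 1 / real (Suc r)"
proof -
  obtain s :: "nat \<Rightarrow> nat" where s: "strict_mono s" "s 0 = 1"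
    and pos: "\<And>r j i. j \<in> {1..N} \<Longrightarrow> i \<le> Suc r * s r \<Longrightarrow> i + n j i < s (Suc r)"
    and tail: "\<And>r j i. j \<in> {1..N} \<Longrightarrow> i \<le> Suc r * s r \<Longrightarrow>
       B j i * seq_norm X (\<lambda>m. if m < s (Suc r) then 0 else y m) < 1 / real (Suc r)"
    by (rule ex_block_boundaries[OF y(1), of n], rule that)
  define E where "E = (\<Union>r\<in>{r. even r}. {s r..<s (Suc r)})"
  define z :: "nat \<Rightarrow> 'a" where "z m = (if m \<in> E then of_real (a m * y m) else 0)" for m
  have nz: "norm (z m) = (if m \<in> E then a m * y m else 0)" for m
    using a_pos[of m] y(2)[of m] by (auto simp: z_def abs_mult simp del: of_real_mult)
  show ?thesis
  proof
    show "norm (z m) \<le> a m * y m" for m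
      using a_pos[of m] y(2)[of m] by (simp add: nz)
  next
    fix r j i assume r: "even r" and j: "j \<in> {1..N}" and i: "i \<in> {s r..Suc r * s r}"
    have "i + n j i \<in> E"
      unfolding E_def using r i pos[OF j, of i r] by (intro UN_I[of r]) auto
    moreover have "(\<Prod>l\<in>{n j i..<i + n j i}. \<omega> j l) > 0"
      using weight_pos j by (intro prod_pos) auto
    ultimately show "norm ((T j ^^ i) z (n j i)) = shift_term a (\<omega> j) i (n j i) * y (i + n j i)"
      by (simp add: funpow_weighted_shift nz shift_term_def)
  next
    fix r j i assume r: "odd r" and j: "j \<in> {1..N}" and i: "i \<in> {s r..Suc r * s r}"
    define t where "t m = (if m < s (Suc r) then 0 else y m)" for m
    have t: "t \<in> seq_carrier X"
      by (rule seq_shift_dominated(1)[OF X y(1), of 1 _ 0]) (auto simp: t_def)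
    \<comment> \<open>\<open>z\<close> vanishes on the odd block \<open>{s r..<s (Suc r)}\<close>, so from \<open>i \<ge> s r\<close> on only the tail counts.\<close>
    have "norm (z m) \<le> 1 * (a m * norm (t m))" if m: "m \<ge> i" for m
    proof (cases "m \<in> E \<and> m < s (Suc r)")
      case True
      then obtain r' where r': "even r'" "s r' \<le> m" "m < s (Suc r')" by (auto simp: E_def)
      have "s r < s (Suc r')" "s r' < s (Suc r)" using r' m i True by auto
      then have "r < Suc r'" "r' < Suc r" using strict_mono_less[OF s(1)] by auto
      then have "r = r'" by simp
      then show ?thesis using r r' by simp
    next
      case False
      then show ?thesis using a_pos[of m] y(2)[of m] by (auto simp: nz t_def)
    qed
    from orbit_bound(2)[OF j _ t this] have "seq_norm X ((T j ^^ i) z) \<le> B j i * seq_norm X t"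
      by simp
    also have "\<dots> < 1 / real (Suc r)" using tail[OF j, of i r] i by (simp add: t_def[abs_def])
    finally show "seq_norm X ((T j ^^ i) z) < 1 / real (Suc r)" .
  qed (use s in auto)
qed

text \<open>
  The scrambled set is \<open>{v c + c *\<^sub>R z | c. c \<in> \<real>}\<close> with \<open>z\<close> irregular and \<open>v c\<close> finitely
  supported. Different elements have different \<open>c\<close>, so \<open>z\<close> always survives in their difference,
  with a nonzero factor.
  Since the large values along the orbits of \<open>z\<close> are unbounded, this factor is harmless and
  \<open>\<sigma> = 1\<close> serves all pairs.
\<close>

lemma distributionally_chaotic_if_profile:
  fixes y :: "nat \<Rightarrow> real" and n :: "nat \<Rightarrow> nat \<Rightarrow> nat"
  assumes N: "N \<ge> 1"
    and y: "y \<in> seq_carrier X" "\<And>i. y i \<ge> 0"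
    and lim: "\<And>j. j \<in> {1..N} \<Longrightarrow>
      filterlim (\<lambda>k. shift_term a (\<omega> j) k (n j k) * y (k + n j k)) at_top sequentially"
  shows "densely_d1_distributionally_chaotic
           (seq_carrier X :: (nat \<Rightarrow> 'a::{real_normed_field, euclidean_space}) set)
           (seq_norm X) N (\<lambda>j. weighted_shift_dom X (\<omega> j)) (\<lambda>j. T j)"
proof -
  obtain s :: "nat \<Rightarrow> nat" and z :: "nat \<Rightarrow> 'a" where s: "strict_mono s" "s 0 = 1"
    and z: "\<And>m. norm (z m) \<le> a m * y m"
    and big: "\<And>r j i. even r \<Longrightarrow> j \<in> {1..N} \<Longrightarrow> i \<in> {s r..Suc r * s r} \<Longrightarrow>
       norm ((T j ^^ i) z (n j i)) = shift_term a (\<omega> j) i (n j i) * y (i + n j i)"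
    and small: "\<And>r j i. odd r \<Longrightarrow> j \<in> {1..N} \<Longrightarrow> i \<in> {s r..Suc r * s r} \<Longrightarrow>
       seq_norm X ((T j ^^ i) z) < 1 / real (Suc r)"
    by (rule ex_irregular_vector[OF y, of n], rule that)
  obtain D :: "'a set" where D: "countable D" "\<And>U. open U \<Longrightarrow> U \<noteq> {} \<Longrightarrow> \<exists>d\<in>D. d \<in> U"
    using countable_dense_setE by blast
  define e where "e = from_nat_into (lists D)"
  have range_e: "range e = lists D"
    unfolding e_def using D(1) by (intro range_from_nat_into countable_lists) auto
  \<comment> \<open>The \<open>i\<close>-th finite sequence occurs at every \<open>c = 1 / prod_encode (i, k)\<close>, and \<open>k\<close> makes \<open>c\<close> small.\<close>
  define v where "v c = (nth_default 0 (e (fst (prod_decode (nat \<lfloor>1 / c\<rfloor>)))) :: nat \<Rightarrow> 'a)" for c :: real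
  define g where "g c = (\<lambda>m. v c m + c *\<^sub>R z m)" for c
  define S where "S = range g"
  have v_finite: "\<exists>M. \<forall>m\<ge>M. v c m = 0" for c
    unfolding v_def by (metis nth_default_beyond)
  have g_orbit: "(T j ^^ k) (g c) \<in> seq_carrier X" if j: "j \<in> {1..N}" for j k c
  proof -
    define w where "w m = norm (v c m) / a m + \<bar>c\<bar> * y m" for m
    obtain M where "\<forall>m\<ge>M. v c m = 0" using v_finite by blast
    then have 1: "(\<lambda>m. norm (v c m) / a m) \<in> seq_carrier X"
      by (intro finite_support_in_seq_carrier[OF X, of M]) auto
    have 2: "(\<lambda>m. \<bar>c\<bar> * y m) \<in> seq_carrier X"
      by (rule seq_shift_dominated(1)[OF X y(1), of "\<bar>c\<bar>" _ 0]) (auto simp: abs_mult)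
    have w: "w \<in> seq_carrier X" using seq_add(1)[OF X 1 2] by (simp add: w_def[abs_def])
    have "norm (g c m) \<le> 1 * (a m * norm (w m))" for m
    proof -
      have "norm (g c m) \<le> norm (v c m) + \<bar>c\<bar> * norm (z m)"
        unfolding g_def by (rule order_trans[OF norm_triangle_ineq]) simp
      also have "\<dots> \<le> norm (v c m) + \<bar>c\<bar> * (a m * y m)"
        using z by (intro add_left_mono mult_left_mono) auto
      also have "\<dots> = a m * w m" using a_pos[of m] by (simp add: w_def field_simps)
      also have "\<dots> \<le> a m * norm (w m)" using a_pos[of m] by (intro mult_left_mono) auto
      finally show ?thesis by simp
    qed
    then show ?thesis by (intro orbit_bound(1)[OF j _ w, of 1]) auto
  qed
  have z_orbit: "(T j ^^ k) z \<in> seq_carrier X" if j: "j \<in> {1..N}" for j k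
    using z y(2) by (intro orbit_bound(1)[OF j _ y(1), of 1]) auto
  have orbit_diff: "\<exists>K. \<forall>k\<ge>K. \<forall>j. (T j ^^ k) (g c) - (T j ^^ k) (g c') = (\<lambda>m. (c - c') *\<^sub>R (T j ^^ k) z m)"
    for c c'
  proof -
    obtain M M' where "\<forall>m\<ge>M. v c m = 0" "\<forall>m\<ge>M'. v c' m = 0" using v_finite by metis
    then show ?thesis
      by (intro exI[of _ "max M M'"])
        (auto simp: fun_eq_iff funpow_weighted_shift g_def algebra_simps)
  qed
  have large_density: "upper_density (\<Inter>j\<in>{1..N}. {k. seq_norm X ((T j ^^ k) (g c) - (T j ^^ k) (g c')) \<ge> 1}) = 1"
    if c: "c \<noteq> c'" for c c'
  proof -
    obtain K where K: "\<And>k j. k \<ge> K \<Longrightarrow>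
        (T j ^^ k) (g c) - (T j ^^ k) (g c') = (\<lambda>m. (c - c') *\<^sub>R (T j ^^ k) z m)"
      using orbit_diff by metis
    have "eventually (\<lambda>k. \<forall>j\<in>{1..N}. shift_term a (\<omega> j) k (n j k) * y (k + n j k) \<ge> 1 / \<bar>c - c'\<bar>)
        sequentially"
      using lim by (intro eventually_ball_finite) (auto simp: filterlim_at_top)
    then obtain R where R: "\<And>k j. k \<ge> R \<Longrightarrow> j \<in> {1..N} \<Longrightarrow>
        shift_term a (\<omega> j) k (n j k) * y (k + n j k) \<ge> 1 / \<bar>c - c'\<bar>"
      unfolding eventually_sequentially by blast
    define \<rho> where "\<rho> k = 2 * (k + R + K)" for k
    show ?thesis
    proof (rule upper_density_1_if_long_intervals[OF s(1)])
      show "strict_mono \<rho>" by (simp add: strict_mono_def \<rho>_def)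
      fix l
      show "{s (\<rho> l)..Suc (\<rho> l) * s (\<rho> l)}
          \<subseteq> (\<Inter>j\<in>{1..N}. {k. seq_norm X ((T j ^^ k) (g c) - (T j ^^ k) (g c')) \<ge> 1})"
      proof (intro subsetI INT_I CollectI)
        fix k j assume k: "k \<in> {s (\<rho> l)..Suc (\<rho> l) * s (\<rho> l)}" and j: "j \<in> {1..N}"
        have "\<rho> l \<le> s (\<rho> l)" using s(1) by (rule strict_mono_imp_increasing)
        then have kR: "k \<ge> R" "k \<ge> K" using k by (auto simp: \<rho>_def)
        have "1 = \<bar>c - c'\<bar> * (1 / \<bar>c - c'\<bar>)" using c by simp
        also have "\<dots> \<le> \<bar>c - c'\<bar> * norm ((T j ^^ k) z (n j k))"
          using R[OF kR(1) j] big[OF _ j k] by (intro mult_left_mono) (auto simp: \<rho>_def)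
        also have "\<dots> = norm ((c - c') *\<^sub>R (T j ^^ k) z (n j k))" by simp
        also have "\<dots> \<le> seq_norm X (\<lambda>m. (c - c') *\<^sub>R (T j ^^ k) z m)"
          using seq_shift_dominated(1)[OF X z_orbit[OF j, of k],
              of "\<bar>c - c'\<bar>" "\<lambda>m. (c - c') *\<^sub>R (T j ^^ k) z m" 0]
          by (intro norm_coordinate_le_seq_norm[OF X]) auto
        finally show "seq_norm X ((T j ^^ k) (g c) - (T j ^^ k) (g c')) \<ge> 1" using K kR by simp
      qed
    qed (use s in auto)
  qed
  have small_density: "upper_density (\<Inter>j\<in>{1..N}. {k. seq_norm X ((T j ^^ k) (g c) - (T j ^^ k) (g c')) < \<epsilon>}) = 1"
    if \<epsilon>: "\<epsilon> > 0" for c c' \<epsilon>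
  proof -
    obtain K where K: "\<And>k j. k \<ge> K \<Longrightarrow>
        (T j ^^ k) (g c) - (T j ^^ k) (g c') = (\<lambda>m. (c - c') *\<^sub>R (T j ^^ k) z m)"
      using orbit_diff by metis
    obtain R :: nat where R: "\<bar>c - c'\<bar> / \<epsilon> < real R" using reals_Archimedean2 by blast
    define \<rho> where "\<rho> k = 2 * (k + R + K) + 1" for k
    show ?thesis
    proof (rule upper_density_1_if_long_intervals[OF s(1)])
      show "strict_mono \<rho>" by (simp add: strict_mono_def \<rho>_def)
      fix l
      show "{s (\<rho> l)..Suc (\<rho> l) * s (\<rho> l)}
          \<subseteq> (\<Inter>j\<in>{1..N}. {k. seq_norm X ((T j ^^ k) (g c) - (T j ^^ k) (g c')) < \<epsilon>})"
      proof (intro subsetI INT_I CollectI)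
        fix k j assume k: "k \<in> {s (\<rho> l)..Suc (\<rho> l) * s (\<rho> l)}" and j: "j \<in> {1..N}"
        have "\<rho> l \<le> s (\<rho> l)" using s(1) by (rule strict_mono_imp_increasing)
        then have kK: "k \<ge> K" using k by (auto simp: \<rho>_def)
        have "seq_norm X (\<lambda>m. (c - c') *\<^sub>R (T j ^^ k) z m) \<le> \<bar>c - c'\<bar> * seq_norm X ((T j ^^ k) z)"
          by (rule seq_shift_dominated(2)[where k = 0, OF X z_orbit[OF j]]) auto
        also have "\<dots> \<le> \<bar>c - c'\<bar> * (1 / real (Suc (\<rho> l)))"
          using small[OF _ j k] by (intro mult_left_mono) (auto simp: \<rho>_def)
        also have "\<dots> < \<epsilon>"
        proof -
          have "\<bar>c - c'\<bar> < \<epsilon> * real R" using R \<epsilon> by (simp add: field_simps)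
          also have "\<dots> \<le> \<epsilon> * real (Suc (\<rho> l))"
            using \<epsilon> by (intro mult_left_mono) (auto simp: \<rho>_def)
          finally show ?thesis by (simp add: field_simps)
        qed
        finally show "seq_norm X ((T j ^^ k) (g c) - (T j ^^ k) (g c')) < \<epsilon>" using K kK by simp
      qed
    qed (use s in auto)
  qed
  have dense: "\<exists>t\<in>S. seq_norm X (x - t) < \<delta>" if x: "x \<in> seq_carrier X" and \<delta>: "\<delta> > 0" for x \<delta>
  proof -
    obtain l where l: "l \<in> lists D" "(\<lambda>m. x m - nth_default 0 l m) \<in> seq_carrier X"
      "seq_norm X (\<lambda>m. x m - nth_default 0 l m) < \<delta> / 8"
      using finite_sequences_dense[OF X x _ D(2), of "\<delta> / 8"] \<delta> by auto
    obtain i where i: "e i = l" using l(1) range_e by (metis imageE)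
    obtain A where A: "\<And>m. a m \<le> A"
      using bounded_a bounded_imp_bdd_above[of "range a"] by (auto simp: bdd_above_def)
    have A0: "A \<ge> 0" using A[of 0] a_pos[of 0] by linarith
    have "norm (z m) \<le> A * norm (y (m + 0))" for m
      using z[of m] A[of m] y(2)[of m] mult_right_mono[of "a m" A "y m"] by simp
    note zX = seq_shift_dominated(1)[OF X y(1) A0 this]
    have nz: "seq_norm X z \<ge> 0" by (rule seq_norm_nonneg[OF X zX])
    obtain k :: nat where k: "8 * seq_norm X z / \<delta> < real k" "k \<ge> 1"
      using reals_Archimedean2[of "8 * seq_norm X z / \<delta>"] nz \<delta>
      by (metis One_nat_def Suc_leI divide_nonneg_pos le_less_trans mult_nonneg_nonneg
          of_nat_0_less_iff zero_le_numeral)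
    define c where "c = 1 / real (prod_encode (i, k))"
    have ge: "prod_encode (i, k) \<ge> k" by (rule le_prod_encode_2)
    have vc: "v c = nth_default 0 l" using i by (simp add: v_def c_def)
    have c0: "c \<ge> 0" by (simp add: c_def)
    have "seq_norm X z < \<delta> / 8 * real k" using k \<delta> by (simp add: field_simps)
    also have "\<dots> \<le> \<delta> / 8 * real (prod_encode (i, k))" using ge \<delta> by (intro mult_left_mono) auto
    finally have cz: "c * seq_norm X z < \<delta> / 8"
      using ge k(2) by (simp add: c_def field_simps)
    have "norm (- (c *\<^sub>R z m)) \<le> c * norm (z (m + 0))" for m using c0 by simp
    note czX = seq_shift_dominated[OF X zX c0 this]
    have eq: "x - g c = (\<lambda>m. (x m - nth_default 0 l m) + (- (c *\<^sub>R z m)))"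
      by (auto simp: g_def vc)
    have "seq_norm X (x - g c) < \<delta>"
      unfolding eq by (rule seq_norm_add_less[OF X l(2) czX(1) l(3) order_le_less_trans[OF czX(2) cz]])
    then show ?thesis by (auto simp: S_def)
  qed
  \<comment> \<open>The orbits of distinct elements are often at distance at least 1, so the elements differ.\<close>
  have "inj g"
  proof (rule injI, rule ccontr)
    fix c c' assume eq: "g c = g c'" and ne: "c \<noteq> c'"
    have "(\<lambda>_. 0 :: 'a) \<in> seq_carrier X" by (rule finite_support_in_seq_carrier[OF X]) simp
    from seq_shift_dominated(2)[where k = 0, OF X this, of 0 "\<lambda>_. 0 :: 'a"]
    have "seq_norm X (\<lambda>_. 0 :: 'a) \<le> 0" by simp
    then have "(\<Inter>j\<in>{1..N}. {k. seq_norm X ((T j ^^ k) (g c) - (T j ^^ k) (g c')) \<ge> 1}) = {}"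
      using N unfolding eq by (auto simp: fun_diff_def intro!: bexI[of _ 1])
    moreover have "upper_density {} = 0"
      by (simp add: upper_density_def Limsup_const zero_ereal_def)
    ultimately show False using large_density[OF ne] by simp
  qed
  then have unc: "uncountable S"
    unfolding S_def using uncountable_UNIV_real by (metis countable_image_inj_on)
  have dom: "S \<subseteq> (\<Inter>j\<in>{1..N}. dom_infty (seq_carrier X) (weighted_shift_dom X (\<omega> j)) (T j))"
    unfolding S_def using g_orbit by (auto intro!: dom_infty_if_orbit_in_carrier)
  show ?thesis
    unfolding densely_d1_distributionally_chaotic_def
  proof (intro exI[of _ S] exI[of _ 1] conjI allI ballI impI)
    fix \<epsilon> :: real and x x' assume \<epsilon>: "\<epsilon> > 0" and "x \<in> S" "x' \<in> S" and ne: "x \<noteq> x'"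
    then obtain c c' where "x = g c" "x' = g c'" by (auto simp: S_def)
    with ne large_density[of c c'] small_density[OF \<epsilon>, of c c']
    show "upper_density (\<Inter>j\<in>{1..N}. {k. seq_norm X ((T j ^^ k) x - (T j ^^ k) x') \<ge> 1}) = 1"
      and "upper_density (\<Inter>j\<in>{1..N}. {k. seq_norm X ((T j ^^ k) x - (T j ^^ k) x') < \<epsilon>}) = 1"
      by auto
  qed (use unc dom dense in auto)
qed

end

theorem theorem4p11:
  fixes X :: seq_space and N :: nat
    and \<omega> :: "nat \<Rightarrow> nat \<Rightarrow> real" and a :: "nat \<Rightarrow> real"
  assumes "N \<ge> 2"
    and "(\<exists>p\<ge>1. X = Lp p) \<or> X = C0"
    and "\<And>j n. j \<in> {1..N} \<Longrightarrow> \<omega> j n > 0"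
    and "\<And>n. a n > 0"
    and "bounded (range a)"
    and "\<And>j k. j \<in> {1..N} \<Longrightarrow> k \<ge> 1 \<Longrightarrow> bdd_above (range (shift_term a (\<omega> j) k))"
    and "(((\<exists>p. X = Lp p \<and> p \<noteq> 2) \<or> X = C0)
            \<and> (\<forall>j\<in>{1..N}. summable (\<lambda>k. 1 / shift_bound a (\<omega> j) (Suc k))))
       \<or> (X = Lp 2
            \<and> (\<forall>j\<in>{1..N}. summable (\<lambda>k. 1 / (shift_bound a (\<omega> j) (Suc k))\<^sup>2)))"
  shows "densely_d1_distributionally_chaotic
           (seq_carrier X :: (nat \<Rightarrow> 'a::{real_normed_field, euclidean_space}) set)
           (seq_norm X) N
           (\<lambda>j. weighted_shift_dom X (\<omega> j)) (\<lambda>j. weighted_shift (\<omega> j))"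
proof -
  interpret dominated_shifts X N \<omega> a
    using assms by unfold_locales (auto simp: classical_space_def)
  obtain q :: nat where q: "q \<ge> 1"
    and s: "\<And>j. j \<in> {1..N} \<Longrightarrow> summable (\<lambda>k. 1 / B j (Suc k) ^ q)"
    and embed: "\<And>y::nat \<Rightarrow> real. (\<And>i. y i \<ge> 0) \<Longrightarrow> summable (\<lambda>i. y i ^ q) \<Longrightarrow> y \<in> seq_carrier X"
    using assms(7)
  proof
    assume "((\<exists>p. X = Lp p \<and> p \<noteq> 2) \<or> X = C0)
            \<and> (\<forall>j\<in>{1..N}. summable (\<lambda>k. 1 / shift_bound a (\<omega> j) (Suc k)))"
    then show thesis
      by (intro that[of 1] summable_in_seq_carrier[OF X]) auto
  next
    assume "X = Lp 2
            \<and> (\<forall>j\<in>{1..N}. summable (\<lambda>k. 1 / (shift_bound a (\<omega> j) (Suc k))\<^sup>2))"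
    then show thesis by (intro that[of 2]) auto
  qed
  obtain y :: "nat \<Rightarrow> real" and n where "\<And>i. y i \<ge> 0" "y \<in> seq_carrier X"
    "\<And>j. j \<in> {1..N} \<Longrightarrow>
      filterlim (\<lambda>k. shift_term a (\<omega> j) k (n j k) * y (k + n j k)) at_top sequentially"
    using ex_profile[OF q s embed] by blast
  then show ?thesis using assms(1) by (intro distributionally_chaotic_if_profile[of y n]) auto
qed

end
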